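(* Let $K=K(r)$ be a two-bridge knot or a two-component two-bridge link, and let $\Delta_K(t)$ be its Alexander polynomial. Then every zero $\alpha\in\mathbb{C}$ of $\Delta_K(t)$ satisfies $$-3<\operatorname{Re}(\alpha)<6.$$
   Context: A two-bridge knot or two-component two-bridge link is identified by a rational number $r=\beta/\alpha'$ ($0<\beta<\alpha'$, coprime), where one may assume that one of $\alpha',\beta$ is even; it is denoted $K(r)$. Such $r$ has a unique even negative continued fraction expansion $$r=[2a_1,2a_2,\ldots,2a_m]:=\cfrac{1}{2a_1-\cfrac{1}{2a_2-\cfrac{1}{\ddots-\cfrac{1}{2a_m}}}},$$ with $a_1,\ldots,a_m$ nonzero integers, $m\ge 1$; $K(r)$ is a knot if $m$ is even and a two-component link if $m$ is odd. The expansion gives a diagram of $K(r)$ and a minimal genus Seifert surface whose Seifert matrix is the $m\times m$ matrix $U=(u_{ij})$ with $u_{ii}=a_i$ for all $i$; $u_{i,i-1}=-1$ for every even $i$ with $2\le i\le m$; $u_{i,i+1}=1$ for every even $i$ with $i+1\le m$; and all other entries $0$. The Alexander polynomial is $\Delta_{K(r)}(t)=\det(tU-U^T)$ with this $U$. *)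

theory Defs
  imports Complex_Main "Jordan_Normal_Form.Determinant"
begin

fun neg_cf :: "int list \<Rightarrow> rat" where
  "neg_cf [] = 0"
| "neg_cf (a # as) = 1 / (2 * of_int a - neg_cf as)"

definition is_even_expansion :: "rat \<Rightarrow> int list \<Rightarrow> bool" where
  "is_even_expansion r as \<longleftrightarrow> as \<noteq> [] \<and> 0 \<notin> set as \<and> neg_cf as = r"

text \<open>
  Well defined for the slopes of two-bridge knots and links: see the lemma
  \<open>even_expansion_ex1\<close> below.
\<close>

definition even_expansion :: "rat \<Rightarrow> int list" where
  "even_expansion r = (THE as. is_even_expansion r as)"

text \<open>
  Matrix and list indices start at 0, so the even rows of the usual 1-based description
  are the rows with odd index here.
\<close>

definition seifert_matrix :: "int list \<Rightarrow> int mat" where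
  "seifert_matrix as = mat (length as) (length as) (\<lambda>(i, j).
     if j = i then as ! i
     else if odd i \<and> i = Suc j then - 1
     else if odd i \<and> j = Suc i then 1
     else 0)"

definition alexander_polynomial :: "rat \<Rightarrow> int poly" where
  "alexander_polynomial r =
     (let U = seifert_matrix (even_expansion r)
      in det ([:0, 1:] \<cdot>\<^sub>m map_mat (\<lambda>c. [:c:]) U - map_mat (\<lambda>c. [:c:]) (transpose_mat U)))"

lemma abs_neg_cf_less_1: "0 \<notin> set as \<Longrightarrow> \<bar>neg_cf as\<bar> < 1"
proof (induction as)
  case (Cons a as)
  then have IH: "\<bar>neg_cf as\<bar> < 1" and "a \<noteq> 0" by auto
  then have "1 \<le> \<bar>a\<bar>" by linarith
  then have "1 \<le> \<bar>of_int a :: rat\<bar>" by (metis of_int_1_le_iff of_int_abs)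
  with IH have "1 < \<bar>2 * of_int a - neg_cf as\<bar>" by linarith
  then show ?case by simp
qed simp

lemma neg_cf_Cons_nonzero: "0 \<notin> set (a # as) \<Longrightarrow> neg_cf (a # as) \<noteq> 0"
proof -
  assume *: "0 \<notin> set (a # as)"
  then have "\<bar>neg_cf as\<bar> < 1" by (intro abs_neg_cf_less_1) auto
  moreover have "1 \<le> \<bar>a\<bar>" using * by auto
  then have "1 \<le> \<bar>of_int a :: rat\<bar>" by (metis of_int_1_le_iff of_int_abs)
  ultimately have "2 * of_int a - neg_cf as \<noteq> 0" by linarith
  then show ?thesis by simp
qed

lemma neg_cf_inject:
  "0 \<notin> set as \<Longrightarrow> 0 \<notin> set bs \<Longrightarrow> neg_cf as = neg_cf bs \<Longrightarrow> as = bs"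
proof (induction as arbitrary: bs)
  case Nil
  then show ?case using neg_cf_Cons_nonzero by (cases bs) (force, metis neg_cf.simps(1))
next
  case (Cons a as)
  obtain b bs' where bs: "bs = b # bs'"
    using Cons.prems neg_cf_Cons_nonzero by (cases bs) (metis neg_cf.simps(1), auto)
  have eq: "2 * of_int a - neg_cf as = 2 * of_int b - neg_cf bs'"
    using Cons.prems(3) by (simp add: bs)
  have "\<bar>neg_cf as\<bar> < 1" "\<bar>neg_cf bs'\<bar> < 1"
    using Cons.prems by (auto intro!: abs_neg_cf_less_1 simp: bs)
  with eq have "\<bar>of_int a - of_int b :: rat\<bar> < 1" by linarith
  then have "\<bar>of_int (a - b) :: rat\<bar> < 1" by simp
  then have "a = b" by linarith
  moreover have "as = bs'"
    using Cons.prems eq \<open>a = b\<close> by (intro Cons.IH) (auto simp: bs)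
  ultimately show ?case by (simp add: bs)
qed

lemma neg_cf_exists:
  fixes p q :: int
  assumes "\<bar>q\<bar> < \<bar>p\<bar>" "coprime q p" "even p \<or> even q"
  shows "\<exists>as. 0 \<notin> set as \<and> neg_cf as = of_int q / of_int p"
  using assms
proof (induction "nat \<bar>p\<bar>" arbitrary: p q rule: less_induct)
  case less
  show ?case
  proof (cases "q = 0")
    case True
    then show ?thesis by (intro exI[of _ "[]"]) simp
  next
    case False
    define a where "a = (p + q) div (2 * q)"
    define s where "s = 2 * a * q - p"
    have s: "s = q - (p + q) mod (2 * q)"
      using mult_div_mod_eq[of "2 * q" "p + q"] by (simp add: a_def s_def algebra_simps)
    have "s \<noteq> q"
    proof
      assume "s = q"
      then have "p = q * (2 * a - 1)" by (simp add: s_def algebra_simps)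
      then have "q dvd p" by simp
      then have "is_unit q" using less.prems(2) by (meson coprime_common_divisor dvd_refl)
      then have "odd q" by (metis dvd_trans odd_one)
      then show False using less.prems(3) \<open>p = q * (2 * a - 1)\<close> by auto
    qed
    moreover have "\<bar>s\<bar> \<le> \<bar>q\<bar> \<and> s \<noteq> - q"
      using pos_mod_bound[of "2 * q" "p + q"] pos_mod_sign[of "2 * q" "p + q"]
        neg_mod_bound[of "2 * q" "p + q"] neg_mod_sign[of "2 * q" "p + q"] False
      unfolding s by linarith
    ultimately have "\<bar>s\<bar> < \<bar>q\<bar>" by linarith
    have "a \<noteq> 0" using \<open>\<bar>s\<bar> < \<bar>q\<bar>\<close> less.prems(1) by (auto simp: s_def)
    have "coprime s q"
    proof (rule coprimeI)
      fix d assume "d dvd s" "d dvd q"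
      moreover have "p = 2 * a * q - s" by (simp add: s_def)
      ultimately have "d dvd p" by simp
      then show "is_unit d" using \<open>d dvd q\<close> less.prems(2) by (meson coprime_common_divisor)
    qed
    moreover have "even q \<or> even s" using less.prems(3) by (auto simp: s_def)
    ultimately obtain as where as: "0 \<notin> set as" "neg_cf as = of_int s / of_int q"
      using less.hyps[of q s] \<open>\<bar>s\<bar> < \<bar>q\<bar>\<close> less.prems(1) by fastforce
    have "neg_cf (a # as) = of_int q / of_int p"
      using False less.prems(1) by (simp add: as(2) s_def field_simps)
    with as(1) \<open>a \<noteq> 0\<close> show ?thesis by (intro exI[of _ "a # as"]) simp
  qed
qed

lemma even_expansion_ex1:
  fixes p q :: int
  assumes "0 < q" "q < p" "coprime q p" "even p \<or> even q"
  shows "\<exists>!as. is_even_expansion (of_int q / of_int p) as"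
proof -
  obtain as where as: "0 \<notin> set as" "neg_cf as = of_int q / of_int p"
    using neg_cf_exists[of q p] assms by auto
  moreover have "as \<noteq> []" using as(2) assms by auto
  ultimately show ?thesis
    unfolding is_even_expansion_def by (intro ex1I[of _ as]) (auto intro: neg_cf_inject)
qed

end

(* The matrix t U - U^T is tridiagonal with diagonal (t - 1) a_i, and opposite off-diagonal
   entries multiply to -t. Conjugating by diag(1, q, 1, q, ...) with q = sqrt |t| gives all
   nonzero off-diagonal entries the modulus q, so for |t - 1| >= 2 q the moduli of the coordinates of a
   kernel vector form a convex sequence vanishing at both ends, and the vector is zero. Hence
   every zero satisfies |t - 1|^2 < 4 |t|, a region inside the strip. *)
theory Submission
  imports Defs
begin

text \<open>Nonnegativity makes the first increment nonnegative and convexity makes increments grow,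
  so \<open>w\<close> is nondecreasing and is squeezed between 0 and its last value, which is
  0.\<close>

lemma convex_seq_zero_boundary:
  fixes w :: "nat \<Rightarrow> real"
  assumes convex: "\<And>k. k < n \<Longrightarrow> 2 * w (Suc k) \<le> w k + w (Suc (Suc k))"
    and nonneg: "\<And>k. 0 \<le> w k" and "w 0 = 0" and "w (Suc n) = 0" and "k \<le> Suc n"
  shows "w k = 0"
proof -
  have step: "w j \<le> w (Suc j)" if "j \<le> n" for j
    using that
  proof (induction j)
    case 0
    then show ?case using nonneg[of 1] \<open>w 0 = 0\<close> by simp
  next
    case (Suc j)
    then show ?case using convex[of j] by simp
  qed
  have "w k \<le> w (Suc n)"
    using \<open>k \<le> Suc n\<close>
  proof (induction rule: inc_induct)
    case (step j)
    then show ?case using \<open>\<And>j. j \<le> n \<Longrightarrow> w j \<le> w (Suc j)\<close>[of j] by simp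
  qed simp
  then show ?thesis using nonneg[of k] \<open>w (Suc n) = 0\<close> by simp
qed

text \<open>Off-diagonal entries of U sit in odd rows only, so each row of t U - U^T takes them
  either from t U or from -U^T, and its two neighbours share the factor t or 1 up to sign. The index
  shift with zero padding lets the first and last rows follow the same formula.\<close>

lemma seifert_row_sum:
  fixes t :: complex and x :: "nat \<Rightarrow> complex"
  assumes i: "i < length as" and x0: "x 0 = 0" and xn: "x (Suc (length as)) = 0"
  shows "(\<Sum>j<length as. (t * of_int (seifert_matrix as $$ (i, j)) - of_int (seifert_matrix as $$ (j, i)))
             * x (Suc j))
       = (t - 1) * of_int (as ! i) * x (Suc i)
         + (if odd i then t else 1) * (x (Suc (Suc i)) - x i)"
proof -
  let ?e = "if odd i then t else 1"
  have "(\<Sum>j<length as. (t * of_int (seifert_matrix as $$ (i, j)) - of_int (seifert_matrix as $$ (j, i)))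
             * x (Suc j))
      = (\<Sum>j<length as. (if j = i then (t - 1) * of_int (as ! i) * x (Suc j) else 0)
          + (if j = Suc i then ?e * x (Suc j) else 0) + (if Suc j = i then - ?e * x (Suc j) else 0))"
    using i by (intro sum.cong) (auto simp: seifert_matrix_def algebra_simps)
  also have "\<dots> = (t - 1) * of_int (as ! i) * x (Suc i)
      + (\<Sum>j<length as. if j = Suc i then ?e * x (Suc j) else 0)
      + (\<Sum>j<length as. if Suc j = i then - ?e * x (Suc j) else 0)"
    using i by (simp add: sum.distrib)
  also have "(\<Sum>j<length as. if j = Suc i then ?e * x (Suc j) else 0) = ?e * x (Suc (Suc i))"
  proof (cases "Suc i < length as")
    case False
    then have "Suc i = length as" using i by simp
    then show ?thesis using xn by simp
  qed simp
  also have "(\<Sum>j<length as. if Suc j = i then - ?e * x (Suc j) else 0) = - ?e * x i"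
    using i x0 by (cases i) simp_all
  finally show ?thesis by (simp add: algebra_simps)
qed

lemma det_seifert_nonzero:
  fixes t :: complex
  assumes "0 \<notin> set as" and "t \<noteq> 0" and large: "4 * cmod t \<le> (cmod (t - 1))\<^sup>2"
  shows "det (mat (length as) (length as) (\<lambda>(i, j).
    t * of_int (seifert_matrix as $$ (i, j)) - of_int (seifert_matrix as $$ (j, i)))) \<noteq> 0"
    (is "det ?M \<noteq> 0")
proof
  define n where "n = length as"
  assume "det ?M = 0"
  then obtain v where v: "v \<in> carrier_vec n" "v \<noteq> 0\<^sub>v n" "?M *\<^sub>v v = 0\<^sub>v n"
    using det_0_iff_vec_prod_zero_field[of ?M n] by (auto simp: n_def)
  define x where "x k = (if 0 < k \<and> k \<le> n then v $ (k - 1) else 0)" for k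
  define q where "q = sqrt (cmod t)"
  \<comment> \<open>The diagonal conjugation: \<open>x k\<close> is coordinate k - 1, so even
    \<open>k\<close> belongs to the odd rows, whose coordinates are rescaled by
    \<open>q\<close>.\<close>
  define w where "w k = cmod (x k) / (if even k then q else 1)" for k
  have q: "0 < q" "cmod t = q\<^sup>2" using \<open>t \<noteq> 0\<close> by (simp_all add: q_def)
  have "(2 * q)\<^sup>2 \<le> (cmod (t - 1))\<^sup>2" using large q by (simp add: power_mult_distrib)
  then have c: "2 * q \<le> cmod (t - 1)" by (rule power2_le_imp_le) simp
  have x: "cmod (x k) = w k * (if even k then q else 1)" for k
    using q by (simp add: w_def)
  have w_nonneg: "0 \<le> w k" for k
    using q by (simp add: w_def)
  have convex: "2 * w (Suc i) \<le> w i + w (Suc (Suc i))" if i: "i < n" for i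
  proof -
    let ?e = "if odd i then t else 1"
    have "0 = (?M *\<^sub>v v) $ i" using v(3) i by simp
    also have "\<dots> = (\<Sum>j<length as. (t * of_int (seifert_matrix as $$ (i, j))
        - of_int (seifert_matrix as $$ (j, i))) * x (Suc j))"
      using v(1) i by (auto simp: scalar_prod_def x_def n_def lessThan_atLeast0 intro!: sum.cong)
    also have "\<dots> = (t - 1) * of_int (as ! i) * x (Suc i) + ?e * (x (Suc (Suc i)) - x i)"
      using i by (intro seifert_row_sum) (simp_all add: n_def x_def)
    finally have "(t - 1) * of_int (as ! i) * x (Suc i) = ?e * (x i - x (Suc (Suc i)))"
      by (simp add: algebra_simps)
    then have "cmod (t - 1) * \<bar>of_int (as ! i)\<bar> * cmod (x (Suc i))
        = cmod ?e * cmod (x i - x (Suc (Suc i)))"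
      by (metis norm_mult norm_of_int)
    also have "\<dots> \<le> cmod ?e * (cmod (x i) + cmod (x (Suc (Suc i))))"
      by (intro mult_left_mono norm_triangle_ineq4) simp
    finally have upper: "cmod (t - 1) * \<bar>of_int (as ! i)\<bar> * cmod (x (Suc i))
        \<le> cmod ?e * (cmod (x i) + cmod (x (Suc (Suc i))))" .
    \<comment> \<open>Integrality enters here: a nonzero integer has modulus at least 1.\<close>
    have "as ! i \<noteq> 0" using assms(1) i by (metis n_def nth_mem)
    then have "(1::real) \<le> \<bar>of_int (as ! i)\<bar>" by linarith
    then have "2 * q * 1 \<le> cmod (t - 1) * \<bar>of_int (as ! i)\<bar>"
      using c q by (intro mult_mono) auto
    then have "2 * q * cmod (x (Suc i)) \<le> cmod (t - 1) * \<bar>of_int (as ! i)\<bar> * cmod (x (Suc i))"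
      by (intro mult_right_mono) auto
    with upper have "2 * q * cmod (x (Suc i)) \<le> cmod ?e * (cmod (x i) + cmod (x (Suc (Suc i))))"
      by linarith
    \<comment> \<open>\<open>Suc i\<close> has the opposite parity to \<open>i\<close>, while
      \<open>i\<close> and \<open>Suc (Suc i)\<close> agree. Hence both sides carry the same power
      of \<open>q\<close>: the first in even rows, the second in odd rows.\<close>
    then have *: "2 * q * (w (Suc i) * (if odd i then q else 1))
        \<le> (if odd i then q\<^sup>2 else 1) * ((w i + w (Suc (Suc i))) * (if even i then q else 1))"
      unfolding x using q by (auto simp: algebra_simps)
    show ?thesis
    proof (cases "even i")
      case True
      with * have "q * (2 * w (Suc i)) \<le> q * (w i + w (Suc (Suc i)))" by (simp add: algebra_simps)
      then show ?thesis using q by simp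
    next
      case False
      with * have "q\<^sup>2 * (2 * w (Suc i)) \<le> q\<^sup>2 * (w i + w (Suc (Suc i)))"
        by (simp add: algebra_simps power2_eq_square)
      then show ?thesis using q by simp
    qed
  qed
  have "w k = 0" if "k \<le> Suc n" for k
    using convex w_nonneg _ _ that by (rule convex_seq_zero_boundary) (simp_all add: w_def x_def)
  then have "x (Suc i) = 0" if "i < n" for i
    using x[of "Suc i"] that by simp
  then have "v = 0\<^sub>v n"
    using v(1) by (intro eq_vecI) (auto simp: x_def)
  with v(2) show False by simp
qed

text \<open>Evaluation at \<open>t\<close> is a ring homomorphism from integer polynomials to the
  complex numbers, so it commutes with the determinant.\<close>

lemma poly_alexander_polynomial:
  fixes t :: complex and r :: rat
  defines "as \<equiv> even_expansion r"
  shows "poly (map_poly of_int (alexander_polynomial r)) t = det (mat (length as) (length as) (\<lambda>(i, j).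
    t * of_int (seifert_matrix as $$ (i, j)) - of_int (seifert_matrix as $$ (j, i))))"
proof -
  have add: "map_poly of_int (p + q) = (map_poly of_int p + map_poly of_int q :: complex poly)" for p q
    by (intro poly_eqI) (simp add: coeff_map_poly)
  have mult: "map_poly of_int (p * q) = (map_poly of_int p * map_poly of_int q :: complex poly)" for p q
    by (intro poly_eqI) (simp add: coeff_map_poly coeff_mult)
  interpret h: comm_ring_hom "\<lambda>p :: int poly. poly (map_poly of_int p) t"
    by unfold_locales (simp_all add: add mult)
  show ?thesis
    unfolding alexander_polynomial_def Let_def as_def[symmetric] h.hom_det[symmetric]
    by (intro arg_cong[of _ _ det] eq_matI)
      (auto simp: seifert_matrix_def hom_distribs map_poly_pCons)
qed

text \<open>Expand |t - 1|^2 = |t|^2 - 2 Re t + 1. On the left, |t|^2 \<ge> 4 |t| - 4 and -2 Re t +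
  1 \<ge> 7. On the right, 2 Re t \<le> 2 |t| and |t|^2 \<ge> 6 |t|.\<close>

lemma far_from_strip:
  fixes t :: complex
  assumes "\<not> (- 3 < Re t \<and> Re t < 6)"
  shows "4 * cmod t \<le> (cmod (t - 1))\<^sup>2"
proof -
  have eq: "(cmod (t - 1))\<^sup>2 = (cmod t)\<^sup>2 - 2 * Re t + 1"
    unfolding cmod_power2 by (simp add: power2_eq_square algebra_simps)
  have sq: "0 \<le> (cmod t - 2)\<^sup>2" by simp
  show ?thesis
  proof (cases "Re t < 6")
    case True
    then have "Re t \<le> - 3" using assms by simp
    with sq show ?thesis unfolding eq by (simp add: power2_eq_square algebra_simps)
  next
    case False
    then have "6 \<le> cmod t" "Re t \<le> cmod t" using complex_Re_le_cmod[of t] by linarith+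
    then have "6 * cmod t \<le> cmod t * cmod t" by (intro mult_right_mono) auto
    with \<open>Re t \<le> cmod t\<close> show ?thesis unfolding eq by (simp add: power2_eq_square)
  qed
qed

theorem theorem1:
  fixes \<beta> \<alpha>' :: int and \<alpha> :: complex
  assumes "0 < \<beta>" and "\<beta> < \<alpha>'" and "coprime \<beta> \<alpha>'" and "even \<alpha>' \<or> even \<beta>"
    and "poly (map_poly of_int (alexander_polynomial (of_int \<beta> / of_int \<alpha>'))) \<alpha> = 0"
  shows "- 3 < Re \<alpha> \<and> Re \<alpha> < 6"
proof (rule ccontr)
  assume out: "\<not> ?thesis"
  then have "\<alpha> \<noteq> 0" by auto
  \<comment> \<open>Existence and uniqueness of the expansion make the description operator return a
    list with nonzero entries.\<close>
  moreover have "0 \<notin> set (even_expansion (of_int \<beta> / of_int \<alpha>'))"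
    using theI'[OF even_expansion_ex1[OF assms(1-4)]]
    by (simp add: even_expansion_def is_even_expansion_def)
  ultimately show False
    using det_seifert_nonzero far_from_strip[OF out] assms(5)
    by (simp add: poly_alexander_polynomial)
qed

end
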